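(* For all integers $n,m\ge 0$ the following identities hold in the ring $\mathbb{D}$ of dual numbers: (i) $JD_{n+2}^{(3)}+JD_{n+1}^{(3)}+JD_{n}^{(3)}=2^{n+1}JD_{2}^{(3)}$, where $JD_2^{(3)}=1+2\varepsilon$; (ii) $JD_{n+2}^{(3)}-4JD_{n}^{(3)}=\begin{cases}1-2\varepsilon & \text{if } n\equiv 0 \pmod 3,\\ -2+\varepsilon & \text{if } n\equiv 1 \pmod 3,\\ 1+\varepsilon & \text{if } n\equiv 2 \pmod 3;\end{cases}$ (iii) $JD_{n}^{(3)}JD_{m+1}^{(3)}+T_{n-1}^{(3)}JD_{m}^{(3)}+2JD_{n-1}^{(3)}JD_{m-1}^{(3)}=JD_{n+m}^{(3)}+\varepsilon J_{n+m+1}^{(3)}$, where $T_{k}^{(3)}=JD_{k}^{(3)}+2JD_{k-1}^{(3)}$; (iv) $\left(JD_{n+1}^{(3)}\right)^{2}+\left(JD_{n}^{(3)}\right)^{2}+4JD_{n}^{(3)}JD_{n-1}^{(3)}=JD_{2n+1}^{(3)}+\varepsilon J_{2n+2}^{(3)}$.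
   Context: $\mathbb{D}=\mathbb{R}[\varepsilon]=\{a+\varepsilon b: a,b\in\mathbb{R}\}$ with $\varepsilon\ne0$, $\varepsilon^2=0$, is the commutative ring of dual numbers, so $(a_1+\varepsilon b_1)(a_2+\varepsilon b_2)=a_1a_2+\varepsilon(a_1b_2+a_2b_1)$. The third order Jacobsthal numbers $J_n^{(3)}$ are defined by $J_0^{(3)}=0$, $J_1^{(3)}=J_2^{(3)}=1$, and $J_{n+3}^{(3)}=J_{n+2}^{(3)}+J_{n+1}^{(3)}+2J_n^{(3)}$ for $n\ge0$; for negative indices the sequence is extended by requiring the same recurrence for all integers $n$ (with values in $\mathbb{Q}$; e.g. $J_{-1}^{(3)}=0$, $J_{-2}^{(3)}=\tfrac12$). The dual third order Jacobsthal numbers are $JD_n^{(3)}=J_n^{(3)}+\varepsilon J_{n+1}^{(3)}$ for every integer index $n$. *)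

theory Defs
  imports Complex_Main
begin

section \<open>The ring of dual numbers over the reals\<close>

datatype dual_number = Dual (dre: real) (deps: real)

lemma dual_number_eq_iff: "x = y \<longleftrightarrow> dre x = dre y \<and> deps x = deps y"
  by (auto intro: dual_number.expand)

instantiation dual_number :: comm_ring_1
begin

definition zero_dual_number :: dual_number where
  "0 = Dual 0 0"

definition one_dual_number :: dual_number where
  "1 = Dual 1 0"

definition plus_dual_number :: "dual_number \<Rightarrow> dual_number \<Rightarrow> dual_number" where
  "x + y = Dual (dre x + dre y) (deps x + deps y)"

definition uminus_dual_number :: "dual_number \<Rightarrow> dual_number" where
  "- x = Dual (- dre x) (- deps x)"

definition minus_dual_number :: "dual_number \<Rightarrow> dual_number \<Rightarrow> dual_number" where
  "x - y = Dual (dre x - dre y) (deps x - deps y)"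

definition times_dual_number :: "dual_number \<Rightarrow> dual_number \<Rightarrow> dual_number" where
  "x * y = Dual (dre x * dre y) (dre x * deps y + dre y * deps x)"

instance
  by standard
    (simp_all add: zero_dual_number_def one_dual_number_def plus_dual_number_def
      uminus_dual_number_def minus_dual_number_def times_dual_number_def
      dual_number_eq_iff algebra_simps)

end

instantiation dual_number :: real_algebra_1
begin

definition scaleR_dual_number :: "real \<Rightarrow> dual_number \<Rightarrow> dual_number" where
  "r *\<^sub>R x = Dual (r * dre x) (r * deps x)"

instance
  by standard
    (simp_all add: scaleR_dual_number_def plus_dual_number_def times_dual_number_def
      dual_number_eq_iff algebra_simps)

end

definition dual_eps :: dual_number ("\<epsilon>") where
  "\<epsilon> = Dual 0 1"

lemma Dual_eq: "Dual a b = of_real a + \<epsilon> * of_real b"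
  by (simp add: of_real_def dual_eps_def scaleR_dual_number_def one_dual_number_def
      plus_dual_number_def times_dual_number_def)

lemma dual_eps_nonzero: "\<epsilon> \<noteq> 0"
  by (simp add: dual_eps_def zero_dual_number_def)

lemma dual_eps_square: "\<epsilon>\<^sup>2 = 0"
  by (simp add: dual_eps_def zero_dual_number_def power2_eq_square times_dual_number_def)


section \<open>Third order Jacobsthal numbers with integer index\<close>

text \<open>For negative indices the defining recurrence is solved for its lowest term.\<close>

function jacobsthal3 :: "int \<Rightarrow> real" where
  "jacobsthal3 n =
    (if n = 0 then 0
     else if n = 1 \<or> n = 2 then 1
     else if n > 2 then jacobsthal3 (n - 1) + jacobsthal3 (n - 2) + 2 * jacobsthal3 (n - 3)
     else (jacobsthal3 (n + 3) - jacobsthal3 (n + 2) - jacobsthal3 (n + 1)) / 2)"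
  by auto
termination
  by (relation "measure (\<lambda>n. nat (if n \<ge> 0 then n else 3 - n))") auto

declare jacobsthal3.simps [simp del]

lemma jacobsthal3_0: "jacobsthal3 0 = 0"
  and jacobsthal3_1: "jacobsthal3 1 = 1"
  and jacobsthal3_2: "jacobsthal3 2 = 1"
  by (simp_all add: jacobsthal3.simps)

lemma jacobsthal3_rec:
  "jacobsthal3 (n + 3) = jacobsthal3 (n + 2) + jacobsthal3 (n + 1) + 2 * jacobsthal3 n"
proof (cases "n \<ge> 0")
  case True
  then show ?thesis
    by (subst jacobsthal3.simps) (simp add: algebra_simps)
next
  case False
  then show ?thesis
    by (subst (4) jacobsthal3.simps) (simp add: field_simps)
qed

lemma jacobsthal3_minus1: "jacobsthal3 (-1) = 0"
  using jacobsthal3_rec [of "-1"] by (simp add: jacobsthal3_0 jacobsthal3_1 jacobsthal3_2)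

lemma jacobsthal3_minus2: "jacobsthal3 (-2) = 1 / 2"
  using jacobsthal3_rec [of "-2"] by (simp add: jacobsthal3_0 jacobsthal3_1 jacobsthal3_minus1)

lemma jacobsthal3_Rats: "jacobsthal3 n \<in> \<rat>"
proof (induction n rule: jacobsthal3.induct)
  case (1 n)
  then show ?case
    by (subst jacobsthal3.simps) auto
qed


section \<open>Dual third order Jacobsthal numbers\<close>

definition dual_jacobsthal3 :: "int \<Rightarrow> dual_number" where
  "dual_jacobsthal3 n = of_real (jacobsthal3 n) + \<epsilon> * of_real (jacobsthal3 (n + 1))"

definition dual_T3 :: "int \<Rightarrow> dual_number" where
  "dual_T3 k = dual_jacobsthal3 k + 2 * dual_jacobsthal3 (k - 1)"

end

theory Submission
  imports Defs
begin

text \<open>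
  The characteristic polynomial of the recurrence is
  \<open>x^3 - x^2 - x - 2 = (x - 2) (x^2 + x + 1)\<close>. Its solutions, extended over all integers, form a
  three-dimensional space, and evaluation at \<open>0\<close>, \<open>1\<close>, \<open>2\<close> is injective on it
  (\<open>jacobsthal3_recurrence_unique\<close>). Every real identity needed here equates two solutions,
  so only three values have to be compared: the two factors explain the geometric sequence in
  \<open>jacobsthal3_sum\<close> and the sequence of period three in \<open>jacobsthal3_diff\<close>, and translation
  invariance of the recurrence gives the addition formula \<open>jacobsthal3_add\<close>.

  The real part of each dual identity is a real identity at the given index. For the two linear
  identities the dual part is the same real identity at the next index. In a product the dual part is the sum of the products with
  one factor shifted. Shifting either \<open>n\<close> or \<open>m\<close> in the addition formula produces the index
  \<open>n + m + 1\<close>, so this value occurs twice: once inside the dual Jacobsthal number of index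
  \<open>n + m\<close> and once as the extra multiple of \<open>\<epsilon>\<close>. The quadratic identity is the dual addition
  formula for the pair \<open>n + 1\<close>, \<open>n\<close>.
\<close>

text \<open>
  A window of three consecutive values of \<open>f - g\<close> that vanishes can be moved up by the recurrence
  and down by solving the recurrence for its lowest term, so agreement spreads in both directions.
\<close>

lemma jacobsthal3_recurrence_unique:
  fixes f g :: "int \<Rightarrow> real"
  assumes f: "\<And>k. f (k + 3) = f (k + 2) + f (k + 1) + 2 * f k"
    and g: "\<And>k. g (k + 3) = g (k + 2) + g (k + 1) + 2 * g k"
    and init: "f 0 = g 0" "f 1 = g 1" "f 2 = g 2"
  shows "f n = g n"
proof -
  have "f n = g n \<and> f (n + 1) = g (n + 1) \<and> f (n + 2) = g (n + 2)"
  proof (induction n rule: int_induct [where k = 0])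
    case base
    show ?case using init by simp
  next
    case (step1 i)
    then show ?case using f [of i] g [of i] by (simp add: add.assoc)
  next
    case (step2 i)
    then show ?case using f [of "i - 1"] g [of "i - 1"] by (simp add: algebra_simps)
  qed
  then show ?thesis by simp
qed

lemma jacobsthal3_sum:
  "jacobsthal3 (n + 2) + jacobsthal3 (n + 1) + jacobsthal3 n = 2 powi (n + 1)"
proof (rule jacobsthal3_recurrence_unique [where n = n])
  fix k :: int
  show "jacobsthal3 (k + 3 + 2) + jacobsthal3 (k + 3 + 1) + jacobsthal3 (k + 3) =
      (jacobsthal3 (k + 2 + 2) + jacobsthal3 (k + 2 + 1) + jacobsthal3 (k + 2))
      + (jacobsthal3 (k + 1 + 2) + jacobsthal3 (k + 1 + 1) + jacobsthal3 (k + 1))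
      + 2 * (jacobsthal3 (k + 2) + jacobsthal3 (k + 1) + jacobsthal3 k)"
    using jacobsthal3_rec [of k] jacobsthal3_rec [of "k + 1"] jacobsthal3_rec [of "k + 2"]
    by (simp add: add.assoc)
  show "(2 :: real) powi (k + 3 + 1) =
      2 powi (k + 2 + 1) + 2 powi (k + 1 + 1) + 2 * 2 powi (k + 1)"
    by (simp add: power_int_add)
qed (use jacobsthal3_rec [of 0] jacobsthal3_rec [of 1] in
  \<open>simp_all add: jacobsthal3_0 jacobsthal3_1 jacobsthal3_2 power_int_def\<close>)

text \<open>
  Forming \<open>J (n + 2) - 4 * J n\<close> removes the component along \<open>2 ^ n\<close>. What remains is annihilated by
  \<open>x^2 + x + 1\<close>, a divisor of \<open>x^3 - 1\<close>: it has period three and sums to zero over a period.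
\<close>

lemma jacobsthal3_diff:
  "jacobsthal3 (n + 2) - 4 * jacobsthal3 n =
    (if n mod 3 = 0 then 1 else if n mod 3 = 1 then - 2 else 1)"
proof (rule jacobsthal3_recurrence_unique [where n = n])
  fix k :: int
  show "jacobsthal3 (k + 3 + 2) - 4 * jacobsthal3 (k + 3) =
      (jacobsthal3 (k + 2 + 2) - 4 * jacobsthal3 (k + 2))
      + (jacobsthal3 (k + 1 + 2) - 4 * jacobsthal3 (k + 1))
      + 2 * (jacobsthal3 (k + 2) - 4 * jacobsthal3 k)"
    using jacobsthal3_rec [of k] jacobsthal3_rec [of "k + 1"] jacobsthal3_rec [of "k + 2"]
    by (simp add: add.assoc)
  let ?c = "\<lambda>k :: int. (if k mod 3 = 0 then 1 else if k mod 3 = 1 then - 2 else 1) :: real"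
  have "k mod 3 = 0 \<and> (k + 1) mod 3 = 1 \<and> (k + 2) mod 3 = 2
      \<or> k mod 3 = 1 \<and> (k + 1) mod 3 = 2 \<and> (k + 2) mod 3 = 0
      \<or> k mod 3 = 2 \<and> (k + 1) mod 3 = 0 \<and> (k + 2) mod 3 = 1"
    by presburger
  then show "?c (k + 3) = ?c (k + 2) + ?c (k + 1) + 2 * ?c k"
    by auto
qed (use jacobsthal3_rec [of 0] jacobsthal3_rec [of 1] in
  \<open>simp_all add: jacobsthal3_0 jacobsthal3_1 jacobsthal3_2\<close>)

text \<open>
  For fixed \<open>m\<close> both sides are solutions in \<open>n\<close>. The coefficient sequences on the left are \<open>J n\<close>,
  \<open>J (n - 1) + 2 * J (n - 2)\<close> and \<open>2 * J (n - 1)\<close>. At \<open>n = 0, 1, 2\<close> they are \<open>(0, 1, 0)\<close>,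
  \<open>(1, 0, 0)\<close> and \<open>(1, 1, 2)\<close>, so the comparison is trivial twice and then the recurrence itself.
\<close>

lemma jacobsthal3_add:
  "jacobsthal3 n * jacobsthal3 (m + 1)
    + (jacobsthal3 (n - 1) + 2 * jacobsthal3 (n - 2)) * jacobsthal3 m
    + 2 * jacobsthal3 (n - 1) * jacobsthal3 (m - 1) = jacobsthal3 (n + m)"
proof (rule jacobsthal3_recurrence_unique [where n = n])
  fix k :: int
  have shifts: "k + 3 - 1 = k + 2" "k + 3 - 2 = k + 1" "k + 2 - 1 = k + 1" "k + 2 - 2 = k"
    "k + 1 - 1 = k" "k + 1 - 2 = k - 1"
    by simp_all
  note k = jacobsthal3_rec [of k]
  have k1: "jacobsthal3 (k + 2) = jacobsthal3 (k + 1) + jacobsthal3 k + 2 * jacobsthal3 (k - 1)"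
    using jacobsthal3_rec [of "k - 1"] by (simp add: algebra_simps)
  have k2: "jacobsthal3 (k + 1) = jacobsthal3 k + jacobsthal3 (k - 1) + 2 * jacobsthal3 (k - 2)"
    using jacobsthal3_rec [of "k - 2"] by (simp add: algebra_simps)
  show "jacobsthal3 (k + 3) * jacobsthal3 (m + 1)
        + (jacobsthal3 (k + 3 - 1) + 2 * jacobsthal3 (k + 3 - 2)) * jacobsthal3 m
        + 2 * jacobsthal3 (k + 3 - 1) * jacobsthal3 (m - 1)
      = (jacobsthal3 (k + 2) * jacobsthal3 (m + 1)
        + (jacobsthal3 (k + 2 - 1) + 2 * jacobsthal3 (k + 2 - 2)) * jacobsthal3 m
        + 2 * jacobsthal3 (k + 2 - 1) * jacobsthal3 (m - 1))
      + (jacobsthal3 (k + 1) * jacobsthal3 (m + 1)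
        + (jacobsthal3 (k + 1 - 1) + 2 * jacobsthal3 (k + 1 - 2)) * jacobsthal3 m
        + 2 * jacobsthal3 (k + 1 - 1) * jacobsthal3 (m - 1))
      + 2 * (jacobsthal3 k * jacobsthal3 (m + 1)
        + (jacobsthal3 (k - 1) + 2 * jacobsthal3 (k - 2)) * jacobsthal3 m
        + 2 * jacobsthal3 (k - 1) * jacobsthal3 (m - 1))"
    by (simp only: shifts k k1 k2) (simp add: algebra_simps)
  show "jacobsthal3 (k + 3 + m) =
      jacobsthal3 (k + 2 + m) + jacobsthal3 (k + 1 + m) + 2 * jacobsthal3 (k + m)"
    using jacobsthal3_rec [of "k + m"] by (simp add: ac_simps)
qed (use jacobsthal3_rec [of "m - 1"] in
  \<open>simp_all add: jacobsthal3_0 jacobsthal3_1 jacobsthal3_2 jacobsthal3_minus1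
    jacobsthal3_minus2 ac_simps\<close>)

lemma dual_jacobsthal3_Dual: "dual_jacobsthal3 n = Dual (jacobsthal3 n) (jacobsthal3 (n + 1))"
  by (simp add: dual_jacobsthal3_def Dual_eq)

lemma of_real_dual_number: "of_real r = Dual r 0"
  using Dual_eq [of r 0] by simp

lemma numeral_dual_number: "numeral k = Dual (numeral k) 0"
  using of_real_dual_number [of "numeral k"] by simp

lemmas dual_number_arith =
  plus_dual_number_def minus_dual_number_def uminus_dual_number_def times_dual_number_def
  one_dual_number_def numeral_dual_number of_real_dual_number dual_eps_def

lemma dual_jacobsthal3_2: "dual_jacobsthal3 2 = 1 + 2 * \<epsilon>"
  using jacobsthal3_rec [of 0]
  by (simp add: dual_jacobsthal3_Dual dual_number_arith jacobsthal3_0 jacobsthal3_1 jacobsthal3_2)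

lemma dual_jacobsthal3_sum:
  assumes "n \<ge> 0"
  shows "dual_jacobsthal3 (n + 2) + dual_jacobsthal3 (n + 1) + dual_jacobsthal3 n
    = 2 ^ nat (n + 1) * dual_jacobsthal3 2"
proof -
  have "(2 :: dual_number) ^ nat (n + 1) = of_real (2 powi (n + 1))"
    using assms by (simp add: power_int_def)
  then show ?thesis
    using jacobsthal3_sum [of n] jacobsthal3_sum [of "n + 1"]
    by (simp add: dual_jacobsthal3_2, simp add: dual_jacobsthal3_Dual dual_number_arith
        power_int_add ac_simps)
qed

lemma dual_jacobsthal3_diff:
  "dual_jacobsthal3 (n + 2) - 4 * dual_jacobsthal3 n
    = (if n mod 3 = 0 then 1 - 2 * \<epsilon>
       else if n mod 3 = 1 then - 2 + \<epsilon>
       else 1 + \<epsilon>)"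
proof -
  have "n mod 3 = 0 \<and> (n + 1) mod 3 = 1
      \<or> n mod 3 = 1 \<and> (n + 1) mod 3 = 2
      \<or> n mod 3 = 2 \<and> (n + 1) mod 3 = 0"
    by presburger
  then show ?thesis
    using jacobsthal3_diff [of n] jacobsthal3_diff [of "n + 1"]
    by (auto simp: dual_jacobsthal3_Dual dual_number_arith ac_simps)
qed

lemma dual_jacobsthal3_add:
  "dual_jacobsthal3 n * dual_jacobsthal3 (m + 1)
    + dual_T3 (n - 1) * dual_jacobsthal3 m
    + 2 * dual_jacobsthal3 (n - 1) * dual_jacobsthal3 (m - 1)
    = dual_jacobsthal3 (n + m) + \<epsilon> * of_real (jacobsthal3 (n + m + 1))"
proof -
  \<comment> \<open>The dual part of the left side is the sum of the two shifted instances.\<close>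
  have "jacobsthal3 n * jacobsthal3 (m + 2)
        + (jacobsthal3 (n - 1) + 2 * jacobsthal3 (n - 2)) * jacobsthal3 (m + 1)
        + 2 * jacobsthal3 (n - 1) * jacobsthal3 m = jacobsthal3 (n + m + 1)"
    and "jacobsthal3 (n + 1) * jacobsthal3 (m + 1)
        + (jacobsthal3 n + 2 * jacobsthal3 (n - 1)) * jacobsthal3 m
        + 2 * jacobsthal3 n * jacobsthal3 (m - 1) = jacobsthal3 (n + m + 1)"
    using jacobsthal3_add [of n "m + 1"] jacobsthal3_add [of "n + 1" m]
    by (simp_all add: ac_simps)
  then show ?thesis
    using jacobsthal3_add [of n m]
    by (simp add: dual_T3_def dual_jacobsthal3_Dual dual_number_arith
        algebra_simps)
qed

lemma dual_jacobsthal3_square_sum: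
  "(dual_jacobsthal3 (n + 1))\<^sup>2 + (dual_jacobsthal3 n)\<^sup>2
    + 4 * dual_jacobsthal3 n * dual_jacobsthal3 (n - 1)
    = dual_jacobsthal3 (2 * n + 1) + \<epsilon> * of_real (jacobsthal3 (2 * n + 2))"
proof -
  have "n + 1 + n = 2 * n + 1" "2 * n + 1 + 1 = 2 * n + 2"
    by simp_all
  with dual_jacobsthal3_add [of "n + 1" n] show ?thesis
    by (simp add: dual_T3_def power2_eq_square algebra_simps)
qed

theorem theorem2p1:
  fixes n m :: int
  assumes "n \<ge> 0" and "m \<ge> 0"
  shows
    "(dual_jacobsthal3 (n + 2) + dual_jacobsthal3 (n + 1) + dual_jacobsthal3 n
        = 2 ^ nat (n + 1) * dual_jacobsthal3 2
      \<and> dual_jacobsthal3 2 = 1 + 2 * \<epsilon>)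
    \<and> dual_jacobsthal3 (n + 2) - 4 * dual_jacobsthal3 n
        = (if n mod 3 = 0 then 1 - 2 * \<epsilon>
           else if n mod 3 = 1 then - 2 + \<epsilon>
           else 1 + \<epsilon>)
    \<and> dual_jacobsthal3 n * dual_jacobsthal3 (m + 1)
        + dual_T3 (n - 1) * dual_jacobsthal3 m
        + 2 * dual_jacobsthal3 (n - 1) * dual_jacobsthal3 (m - 1)
        = dual_jacobsthal3 (n + m) + \<epsilon> * of_real (jacobsthal3 (n + m + 1))
    \<and> (dual_jacobsthal3 (n + 1))\<^sup>2 + (dual_jacobsthal3 n)\<^sup>2
        + 4 * dual_jacobsthal3 n * dual_jacobsthal3 (n - 1)
        = dual_jacobsthal3 (2 * n + 1) + \<epsilon> * of_real (jacobsthal3 (2 * n + 2))"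
  using dual_jacobsthal3_sum [OF assms(1)] dual_jacobsthal3_2 dual_jacobsthal3_diff [of n]
    dual_jacobsthal3_add [of n m] dual_jacobsthal3_square_sum [of n]
  by blast

end
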